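(* Let $n \ge 1$ be an integer, and let $x, y \in (0,1)$ with $x \le y$. Then $$\prod_{k \in \mathbb{Z}} \left(\frac{y^n + k^n}{x^n + k^n}\right)^2 = \prod_{k=1}^{n} \frac{\cosh\left(2\pi y \sin\left(\frac{(2k-1)\pi}{n}\right)\right) - \cos\left(2\pi y \cos\left(\frac{(2k-1)\pi}{n}\right)\right)}{\cosh\left(2\pi x \sin\left(\frac{(2k-1)\pi}{n}\right)\right) - \cos\left(2\pi x \cos\left(\frac{(2k-1)\pi}{n}\right)\right)}.$$
   Context: The infinite product over $k \in \mathbb{Z}$ is understood as the limit of symmetric partial products, $\prod_{k\in\mathbb{Z}} c_k = \lim_{N\to\infty} \prod_{k=-N}^{N} c_k$ (this matters only for $n=1$). *)

theory Defs
  imports Complex_Main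
begin

end

theory Submission
  imports Defs "HOL-Analysis.Gamma_Function" "HOL-Computational_Algebra.Polynomial"
begin

text \<open>
  Factor \<open>k ^ n + a ^ n\<close> over the complex numbers as the product of the \<open>k - a * \<omega>\<close>, where \<open>\<omega>\<close>
  runs through the \<open>n\<close>-th roots of \<open>-1\<close>. For each \<open>\<omega>\<close> the symmetric product over \<open>k\<close> is, up to a factor
  depending only on \<open>N\<close>, a partial product of Euler's formula for \<open>sin (\<pi> a \<omega>)\<close>; these factors cancel
  in the quotient. Finally, \<open>2 * |sin (u + i v)|\<^sup>2 = cosh (2 v) - cos (2 u)\<close>.
\<close>

text \<open>Both sides are monic of degree \<open>n\<close> in \<open>z\<close> and vanish at the
  same \<open>n\<close> points, the \<open>n\<close>-th roots of \<open>-(a ^ n)\<close>;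
  \<open>a \<noteq> 0\<close> makes these points distinct.\<close>

lemma power_plus_power_eq_prod:
  fixes z a :: complex
  assumes n: "n > 0" and a: "a \<noteq> 0"
  shows "z ^ n + a ^ n = (\<Prod>k=1..n. z - a * cis ((2 * real k - 1) * pi / real n))"
proof -
  define \<omega> where "\<omega> k = a * cis ((2 * real k - 1) * pi / real n)" for k
  define p where "p = monom 1 n + [:a ^ n:]"
  define q where "q = (\<Prod>k=1..n. [:- \<omega> k, 1:])"
  \<comment> \<open>Shifting the index to start at 0 exhibits the points as a fixed nonzero multiple
    of the \<open>n\<close>-th roots of unity, so distinctness carries over from those.\<close>
  have \<omega>: "\<omega> (Suc k) = a * cis (pi / real n) * cis (2 * pi * real k / real n)" for k
    by (simp add: \<omega>_def cis_mult mult.assoc add_divide_distrib ring_distribs mult_ac)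
  have "inj_on (\<lambda>k. cis (2 * pi * real k / real n)) {..<n}"
    using Complex.bij_betw_roots_unity[OF n] by (simp add: bij_betw_def)
  hence "inj_on (\<lambda>k. \<omega> (Suc k)) {..<n}"
    using a by (simp add: inj_on_def \<omega>)
  hence "card ((\<lambda>k. \<omega> (Suc k)) ` {..<n}) = n"
    by (subst card_image) auto
  also have "(\<lambda>k. \<omega> (Suc k)) ` {..<n} = \<omega> ` {1..n}"
    by (simp add: image_image [of \<omega> Suc, symmetric] image_Suc_lessThan)
  finally have card: "card (\<omega> ` {1..n}) = n" .
  have deg_q: "degree q = n"
    by (simp add: q_def degree_prod_sum_eq)
  have "lead_coeff q = 1"
    unfolding q_def by (subst lead_coeff_prod) simp_all
  have root: "\<omega> k ^ n = - (a ^ n)" for k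
  proof -
    have "cis ((2 * real k - 1) * pi / real n) ^ n = cis (2 * real k * pi - pi)"
      using n by (simp add: Complex.DeMoivre left_diff_distrib right_diff_distrib diff_divide_distrib mult_ac)
    also have "\<dots> = -1"
      by (simp add: complex_eq_iff cos_diff sin_diff cos_2npi sin_2npi)
    finally show ?thesis
      by (simp add: \<omega>_def power_mult_distrib)
  qed
  have "p = q"
  \<comment> \<open>The coefficients at \<open>n\<close> agree, so \<open>p - q\<close> has degree
    below \<open>n\<close> and cannot have \<open>n\<close> distinct roots unless it is
    zero.\<close>
  proof (rule poly_eqI_degree_lead_coeff[where A = "\<omega> ` {1..n}" and n = n])
    show "poly.coeff p n = poly.coeff q n"
      using \<open>lead_coeff q = 1\<close> deg_q n by (simp add: p_def coeff_pCons split: nat.splits)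
    show "degree p \<le> n"
      by (auto simp: p_def intro: degree_add_le degree_monom_le)
    show "poly p z = poly q z" if "z \<in> \<omega> ` {1..n}" for z
      using that n by (force simp: p_def q_def poly_monom poly_prod root)
  qed (use card deg_q in auto)
  hence "poly p z = poly q z" by simp
  thus ?thesis
    by (simp add: p_def q_def poly_monom poly_prod \<omega>_def)
qed

text \<open>The factors at \<open>k\<close> and \<open>-k\<close> multiply to
  \<open>-(k\<^sup>2 * (1 - w\<^sup>2 / k\<^sup>2))\<close>, and \<open>k = 0\<close> contributes
  \<open>-w\<close>. The norm removes the signs, the \<open>k\<^sup>2\<close> collect into
  \<open>(fact N)\<^sup>2\<close>, and \<open>pi\<close> is inserted to match Euler's product for
  the sine.\<close>

lemma norm_prod_symmetric_minus:
  fixes w :: complex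
  shows "norm (\<Prod>k=-int N..int N. of_int k - w)
         = (fact N)\<^sup>2 / pi * norm (of_real pi * w * (\<Prod>k=1..N. 1 - w\<^sup>2 / of_nat k ^ 2))"
proof (induction N)
  case 0
  show ?case by (simp add: norm_mult)
next
  case (Suc N)
  have "{- int (Suc N)..int (Suc N)} = insert (- int (Suc N)) (insert (int (Suc N)) {-int N..int N})"
    by auto
  hence "(\<Prod>k=-int (Suc N)..int (Suc N). of_int k - w)
         = ((- of_nat (Suc N) - w) * (of_nat (Suc N) - w)) * (\<Prod>k=-int N..int N. of_int k - w)"
    by (simp add: mult.assoc)
  also have "(- of_nat (Suc N) - w) * (of_nat (Suc N) - w)
             = - (of_nat (Suc N) ^ 2 * (1 - w\<^sup>2 / of_nat (Suc N) ^ 2))"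
    by (simp add: field_simps power2_eq_square del: of_nat_Suc)
  finally have "norm (\<Prod>k=-int (Suc N)..int (Suc N). of_int k - w)
      = real (Suc N) ^ 2 * norm (1 - w\<^sup>2 / of_nat (Suc N) ^ 2) * norm (\<Prod>k=-int N..int N. of_int k - w)"
    by (simp add: norm_mult norm_power del: of_nat_Suc)
  thus ?case
    unfolding Suc.IH by (simp add: norm_mult power_mult_distrib del: of_nat_Suc)
qed

lemma norm_sin_pi_squared:
  "(norm (sin (of_real pi * (of_real a * cis t))))\<^sup>2
   = (cosh (2 * pi * a * sin t) - cos (2 * pi * a * cos t)) / 2"
  by (simp add: norm_sin_squared cosh_def exp_minus field_simps)

theorem corollary2p5:
  fixes n :: nat and x y :: real
  assumes "n \<ge> 1" and "x \<in> {0<..<1}" and "y \<in> {0<..<1}" and "x \<le> y"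
  shows "(\<lambda>N::nat. \<Prod>k = - int N..int N.
            ((y ^ n + real_of_int k ^ n) / (x ^ n + real_of_int k ^ n))\<^sup>2)
          \<longlonglongrightarrow>
         (\<Prod>k = 1..n.
            (cosh (2 * pi * y * sin ((2 * real k - 1) * pi / real n))
               - cos (2 * pi * y * cos ((2 * real k - 1) * pi / real n)))
            / (cosh (2 * pi * x * sin ((2 * real k - 1) * pi / real n))
               - cos (2 * pi * x * cos ((2 * real k - 1) * pi / real n))))"
proof -
  define t where "t j = (2 * real j - 1) * pi / real n" for j
  define S where "S N w = of_real pi * w * (\<Prod>k=1..N. 1 - w\<^sup>2 / of_nat k ^ 2)" for N and w :: complex
  have S_tendsto: "(\<lambda>N. S N w) \<longlonglongrightarrow> sin (of_real pi * w)" for w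
    unfolding S_def by (rule sin_product_formula_complex)
  have halves: "(u / 2) / (v / 2) = u / v" for u v :: real
    by simp
  have prod_power: "(\<Prod>k=-int N..int N. (a ^ n + real_of_int k ^ n)\<^sup>2)
      = (\<Prod>j=1..n. ((fact N)\<^sup>2 / pi * norm (S N (of_real a * cis (t j))))\<^sup>2)"
    if "a \<noteq> 0" for a N
  proof -
    \<comment> \<open>The square of a real number is the squared norm of its complex image, which
      splits along the complex factorization.\<close>
    have "(a ^ n + real_of_int k ^ n)\<^sup>2 = (\<Prod>j=1..n. (norm (of_int k - of_real a * cis (t j)))\<^sup>2)" for k
    proof -
      have "(a ^ n + real_of_int k ^ n)\<^sup>2 = (norm (of_real (real_of_int k ^ n + a ^ n) :: complex))\<^sup>2"
        unfolding norm_of_real by (simp add: add.commute)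
      also have "of_real (real_of_int k ^ n + a ^ n) = (\<Prod>j=1..n. of_int k - of_real a * cis (t j))"
        using power_plus_power_eq_prod[of n "of_real a" "of_int k"] assms(1) that by (simp add: t_def)
      finally show ?thesis
        by (simp add: prod_power_distrib flip: prod_norm)
    qed
    hence "(\<Prod>k=-int N..int N. (a ^ n + real_of_int k ^ n)\<^sup>2)
        = (\<Prod>j=1..n. \<Prod>k=-int N..int N. (norm (of_int k - of_real a * cis (t j)))\<^sup>2)"
      by (simp only:) (rule prod.swap)
    also have "\<dots> = (\<Prod>j=1..n. (norm (\<Prod>k=-int N..int N. of_int k - of_real a * cis (t j)))\<^sup>2)"
      by (simp add: prod_power_distrib flip: prod_norm)
    finally show ?thesis
      by (simp only: norm_prod_symmetric_minus S_def)
  qed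
  \<comment> \<open>The factor \<open>(fact N)\<^sup>2 / pi\<close> is nonzero and the same for
    \<open>x\<close> and \<open>y\<close>, so it cancels for each \<open>j\<close>.\<close>
  have "(\<lambda>N. \<Prod>k = - int N..int N.
            ((y ^ n + real_of_int k ^ n) / (x ^ n + real_of_int k ^ n))\<^sup>2)
      = (\<lambda>N. \<Prod>j=1..n. (norm (S N (of_real y * cis (t j))))\<^sup>2 / (norm (S N (of_real x * cis (t j))))\<^sup>2)"
    using assms(2,3) by (simp add: power_divide prod_dividef prod_power power_mult_distrib prod.distrib)
  also have "\<dots> \<longlonglongrightarrow> (\<Prod>j=1..n. (norm (sin (of_real pi * (of_real y * cis (t j)))))\<^sup>2
                         / (norm (sin (of_real pi * (of_real x * cis (t j)))))\<^sup>2)"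
  proof (intro tendsto_prod tendsto_divide tendsto_power tendsto_norm S_tendsto)
    \<comment> \<open>The limit of each denominator must be nonzero. A zero of the sine would make
      \<open>x * cis (t j)\<close> an integer, and taking norms would make \<open>x\<close> itself
      an integer, against \<open>0 < x < 1\<close>.\<close>
    fix j
    show "(norm (sin (of_real pi * (of_real x * cis (t j)))))\<^sup>2 \<noteq> 0"
    proof
      assume "(norm (sin (of_real pi * (of_real x * cis (t j)))))\<^sup>2 = 0"
      then obtain m :: int where "of_real pi * (of_real x * cis (t j)) = of_real (m * pi)"
        by (auto simp: Complex_Transcendental.sin_eq_0)
      hence "of_real x * cis (t j) = of_int m"
        by simp
      hence "norm (of_real x * cis (t j)) = norm (of_int m :: complex)"
        by (rule arg_cong)
      hence "x = real_of_int \<bar>m\<bar>"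
        using assms(2) by (simp add: norm_mult)
      with assms(2) have "0 < real_of_int \<bar>m\<bar>" "real_of_int \<bar>m\<bar> < 1"
        by auto
      thus False
        unfolding of_int_0_less_iff of_int_less_1_iff by simp
    qed
  qed
  finally show ?thesis
    \<comment> \<open>\<open>halves\<close> cancels the denominator 2 that
      \<open>norm_sin_pi_squared\<close> leaves above and below.\<close>
    by (simp only: norm_sin_pi_squared t_def halves)
qed

end
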